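(* Let $f\in\mathcal{S}^*_{car}$ with $f(z)=z+\sum_{n=2}^{\infty}a_nz^n$, and let $\Gamma_1,\Gamma_2,\Gamma_3$ be its first three logarithmic inverse coefficients. Then $$\left|H_{2,1}(F_{f^{-1}}/2)\right|=\left|\Gamma_1\Gamma_3-\Gamma_2^2\right|\le \frac{71}{324}.$$ The inequality is sharp, i.e. there exists a function $f\in\mathcal{S}^*_{car}$ for which equality holds.
   Context: Let $\mathbb{D}=\{z\in\mathbb{C}:|z|<1\}$, and let $\mathcal{A}$ be the class of analytic functions $f$ on $\mathbb{D}$ with $f(0)=0$, $f'(0)=1$, so $f(z)=z+\sum_{n\ge2}a_nz^n$. For analytic functions $h,g$ on $\mathbb{D}$, $h\prec g$ ($h$ is subordinate to $g$) means that there is an analytic function $w$ on $\mathbb{D}$ with $w(0)=0$ and $|w(z)|\le|z|$ such that $h(z)=g(w(z))$ for all $z\in\mathbb{D}$. The class of starlike functions related to a cardioid is $$\mathcal{S}^*_{car}=\left\{f\in\mathcal{A}:\ \frac{zf'(z)}{f(z)}\prec 1+\tfrac43 z+\tfrac23 z^2\right\};$$ its members are univalent in $\mathbb{D}$, so the inverse $f^{-1}$ is defined and analytic on $|w|<1/4$. The logarithmic inverse coefficients $\Gamma_n$ of $f$ are defined by $$F_{f^{-1}}(w)=\log\frac{f^{-1}(w)}{w}=2\sum_{n=1}^{\infty}\Gamma_nw^n,\quad |w|<\tfrac14,$$ with the branch of the logarithm vanishing at $w=0$; equivalently $\Gamma_1=-\frac12a_2$, $\Gamma_2=-\frac12a_3+\frac34a_2^2$,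 $\Gamma_3=-\frac12\left(a_4-4a_2a_3+\frac{10}{3}a_2^3\right)$. The second Hankel determinant of logarithmic inverse coefficients is $H_{2,1}(F_{f^{-1}}/2)=\begin{vmatrix}\Gamma_1&\Gamma_2\\ \Gamma_2&\Gamma_3\end{vmatrix}=\Gamma_1\Gamma_3-\Gamma_2^2$. *)

theory Defs
  imports "HOL-Complex_Analysis.Complex_Analysis"
begin

abbreviation unit_disc :: "complex set" ("\<bbbD>") where
  "\<bbbD> \<equiv> ball 0 1"

definition class_A :: "(complex \<Rightarrow> complex) set" where
  "class_A = {f. f holomorphic_on \<bbbD> \<and> f 0 = 0 \<and> deriv f 0 = 1}"

definition subordinate :: "(complex \<Rightarrow> complex) \<Rightarrow> (complex \<Rightarrow> complex) \<Rightarrow> bool"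
    (infix "\<prec>\<^sub>s" 50) where
  "h \<prec>\<^sub>s g \<longleftrightarrow> h holomorphic_on \<bbbD> \<and> g holomorphic_on \<bbbD> \<and>
     (\<exists>w. w holomorphic_on \<bbbD> \<and> w 0 = 0 \<and>
        (\<forall>z\<in>\<bbbD>. norm (w z) \<le> norm z \<and> h z = g (w z)))"

text \<open>The quotient \<open>z f'(z) / f(z)\<close> with its removable singularity at \<open>0\<close> filled in
  (for \<open>f(0) = 0\<close>, \<open>f'(0) = 1\<close>, the limit there is \<open>1\<close>).\<close>

definition starlike_quotient :: "(complex \<Rightarrow> complex) \<Rightarrow> complex \<Rightarrow> complex" where
  "starlike_quotient f z = (if z = 0 then 1 else z * deriv f z / f z)"

text \<open>Since division is total and \<open>x / 0 = 0\<close>, the requirement that \<open>f\<close> has no zero in the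
  punctured disc, implicit in the quotient being analytic, is stated explicitly.\<close>

definition S_car :: "(complex \<Rightarrow> complex) set" where
  "S_car = {f \<in> class_A. (\<forall>z\<in>\<bbbD> - {0}. f z \<noteq> 0) \<and>
     starlike_quotient f \<prec>\<^sub>s (\<lambda>z. 1 + 4 / 3 * z + 2 / 3 * z\<^sup>2)}"

text \<open>The function \<open>log (f\<^sup>-\<^sup>1(w) / w)\<close>, where \<open>f\<^sup>-\<^sup>1\<close> is the inverse of \<open>f\<close> restricted to the
  unit disc. The quotient tends to \<open>1\<close> at \<open>0\<close>, so near \<open>0\<close> the principal logarithm is the branch
  vanishing there. It is that branch on all of \<open>|w| < 1/4\<close>: for starlike \<open>f\<close>, the function
  \<open>f(z)/z\<close> is subordinate to \<open>1/(1 - z)\<^sup>2\<close> and so avoids the negative real axis.\<close>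

definition log_inverse :: "(complex \<Rightarrow> complex) \<Rightarrow> complex \<Rightarrow> complex" where
  "log_inverse f w = (if w = 0 then 0 else Ln (inv_into \<bbbD> f w / w))"

text \<open>\<open>\<Gamma>\<^sub>n\<close> is half the \<open>n\<close>-th Taylor coefficient at \<open>0\<close> of the above function.\<close>

definition log_inv_coeff :: "(complex \<Rightarrow> complex) \<Rightarrow> nat \<Rightarrow> complex" where
  "log_inv_coeff f n = fps_nth (fps_expansion (log_inverse f) 0) n / 2"

definition hankel21_log_inv :: "(complex \<Rightarrow> complex) \<Rightarrow> complex" where
  "hankel21_log_inv f =
     det (vector [vector [log_inv_coeff f 1, log_inv_coeff f 2],
                  vector [log_inv_coeff f 2, log_inv_coeff f 3]] :: complex^2^2)"

end

theory Submission
  imports Defs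
begin

text \<open>Write the Schwarz function as \<open>z p(z)\<close> with \<open>|p| \<le> 1\<close> and
  \<open>p(z) = c\<^sub>0 + c\<^sub>1 z + c\<^sub>2 z\<^sup>2 + \<dots>\<close>. Then \<open>f(z) = z exp (h(z))\<close> with
  \<open>h' = 4/3 p + 2/3 z p\<^sup>2\<close>, and \<open>log (f\<^sup>-\<^sup>1(w) / w) = - h (f\<^sup>-\<^sup>1(w))\<close>. Comparing coefficients gives
  \<open>324 (\<Gamma>\<^sub>1 \<Gamma>\<^sub>3 - \<Gamma>\<^sub>2\<^sup>2) = 71 c\<^sub>0\<^sup>4 - 84 c\<^sub>0\<^sup>2 c\<^sub>1 + 48 c\<^sub>0 c\<^sub>2 - 36 c\<^sub>1\<^sup>2\<close>. By the Schur algorithm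
  \<open>c\<^sub>1 = (1 - |c\<^sub>0|\<^sup>2) x\<close> and \<open>c\<^sub>2 = (1 - |c\<^sub>0|\<^sup>2) (y - cnj c\<^sub>0 x\<^sup>2)\<close> with \<open>|x| \<le> 1\<close>,
  \<open>|y| \<le> 1 - |x|\<^sup>2\<close>, and the triangle inequality bounds the right-hand side by \<open>71\<close>, which is
  attained for \<open>p = 1\<close>.\<close>

section \<open>Coefficients of bounded holomorphic functions\<close>

text \<open>The classical Schwarz lemma assumes the strict bound |f| < 1. For 0 < r < 1 the function
  \<open>r * f\<close> satisfies it, and letting r tend to 1 gives the claim.\<close>

lemma Schwarz_Lemma_le:
  assumes holf: "f holomorphic_on \<bbbD>" and f0: "f 0 = 0"
    and le: "\<And>z. z \<in> \<bbbD> \<Longrightarrow> norm (f z) \<le> 1" and z: "z \<in> \<bbbD>"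
  shows "norm (f z) \<le> norm z"
proof (rule field_le_mult_one_interval)
  fix r :: real assume r: "0 < r" "r < 1"
  have "norm (of_real r * f z) \<le> norm z"
  proof (rule Schwarz_Lemma(1))
    show "(\<lambda>z. of_real r * f z) holomorphic_on \<bbbD>"
      by (intro holomorphic_intros holf)
    fix u :: complex assume "norm u < 1"
    then have "r * norm (f u) \<le> r"
      using le[of u] r by (intro mult_left_le) auto
    with r have "r * norm (f u) < 1" by linarith
    then show "norm (of_real r * f u) < 1"
      using r by (simp add: norm_mult)
  qed (use f0 z in auto)
  then show "r * norm (f z) \<le> norm z"
    using r by (simp add: norm_mult)
qed

text \<open>Off the origin the bound on g = f(z)/z is the Schwarz lemma; at 0 it follows by
  continuity of g. The bound on g is not strict, so unimodular constants remain allowed, and one of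
  these is extremal later.\<close>

lemma Schwarz_factor:
  assumes holf: "f holomorphic_on \<bbbD>" and f0: "f 0 = 0"
    and le: "\<And>z. z \<in> \<bbbD> \<Longrightarrow> norm (f z) \<le> 1"
  obtains g where "g holomorphic_on \<bbbD>" "\<And>z. z \<in> \<bbbD> \<Longrightarrow> f z = z * g z"
    "\<And>z. z \<in> \<bbbD> \<Longrightarrow> norm (g z) \<le> 1"
proof -
  obtain g where g: "g holomorphic_on \<bbbD>" "\<And>z. norm z < 1 \<Longrightarrow> f z = z * g z"
    by (rule Schwarz3[OF holf f0]) auto
  have off0: "norm (g z) \<le> 1" if "z \<in> \<bbbD>" "z \<noteq> 0" for z
    using Schwarz_Lemma_le[OF holf f0 le that(1)] g(2)[of z] that
    by (simp add: norm_mult)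
  have "((\<lambda>z. norm (g z)) \<longlongrightarrow> norm (g 0)) (at 0)"
    using holomorphic_on_imp_continuous_on[OF g(1)]
    by (intro tendsto_norm) (simp add: continuous_on_eq_continuous_at isContD)
  moreover have "eventually (\<lambda>z. norm (g z) \<le> 1) (at 0)"
    unfolding eventually_at using off0 by (intro exI[of _ 1]) auto
  ultimately have "norm (g 0) \<le> 1"
    by (rule tendsto_upperbound) simp
  with off0 have "norm (g z) \<le> 1" if "z \<in> \<bbbD>" for z
    using that by (cases "z = 0") auto
  with g show ?thesis by (intro that[of g]) auto
qed

text \<open>The equation is \<open>p(z) = (c + z q(z)) / (1 + cnj c z q(z))\<close> with \<open>c = p(0)\<close>, with the
  denominator cleared so that coefficients can be compared.\<close>

lemma Schur_step:
  assumes hol: "p holomorphic_on \<bbbD>" and le: "\<And>z. z \<in> \<bbbD> \<Longrightarrow> norm (p z) \<le> 1"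
    and lt: "norm (p 0) < 1"
  obtains q where "q holomorphic_on \<bbbD>" "\<And>z. z \<in> \<bbbD> \<Longrightarrow> norm (q z) \<le> 1"
    "\<And>z. z \<in> \<bbbD> \<Longrightarrow> p z * (1 + cnj (p 0) * (z * q z)) = p 0 + z * q z"
proof -
  define c where "c = p 0"
  \<comment> \<open>This is p followed by the disc automorphism that sends p(0) to 0, so a factor z
    can be split off by \<open>Schwarz_factor\<close>.\<close>
  define \<psi> where "\<psi> z = (p z - c) / (1 - cnj c * p z)" for z
  have nz: "1 - cnj c * p z \<noteq> 0" if "z \<in> \<bbbD>" for z
  proof
    assume "1 - cnj c * p z = 0"
    then have "norm c * norm (p z) = 1"
      by (metis complex_mod_cnj eq_iff_diff_eq_0 norm_mult norm_one)
    moreover have "norm c * norm (p z) \<le> norm c * 1"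
      using le[OF that] by (intro mult_left_mono) auto
    ultimately show False using lt by (simp add: c_def)
  qed
  have le\<psi>: "norm (\<psi> z) \<le> 1" if "z \<in> \<bbbD>" for z
  proof -
    have "(norm (1 - cnj c * p z))\<^sup>2 - (norm (p z - c))\<^sup>2 = (1 - (norm c)\<^sup>2) * (1 - (norm (p z))\<^sup>2)"
      unfolding cmod_power2 by (simp add: power2_eq_square algebra_simps)
    also have "\<dots> \<ge> 0"
      using lt le[OF that] by (intro mult_nonneg_nonneg) (auto simp: c_def power_le_one)
    finally have "(norm (p z - c))\<^sup>2 \<le> (norm (1 - cnj c * p z))\<^sup>2" by simp
    then have "norm (p z - c) \<le> norm (1 - cnj c * p z)"
      by (rule power2_le_imp_le) simp
    then show ?thesis
      using nz[OF that] by (simp add: \<psi>_def norm_divide)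
  qed
  have "\<psi> holomorphic_on \<bbbD>"
    unfolding \<psi>_def using nz by (intro holomorphic_intros hol) auto
  moreover have "\<psi> 0 = 0" by (simp add: \<psi>_def c_def)
  ultimately obtain q where q: "q holomorphic_on \<bbbD>" "\<And>z. z \<in> \<bbbD> \<Longrightarrow> \<psi> z = z * q z"
    "\<And>z. z \<in> \<bbbD> \<Longrightarrow> norm (q z) \<le> 1"
    using Schwarz_factor[of \<psi>] le\<psi> by metis
  have "p z * (1 + cnj c * (z * q z)) = c + z * q z" if "z \<in> \<bbbD>" for z
    using nz[OF that] unfolding q(2)[OF that, symmetric] \<psi>_def
    by (simp add: field_simps)
  then show ?thesis
    using q by (intro that[of q]) (auto simp: c_def)
qed

text \<open>Turned into an identity of formal power series, the Schur step gives the coefficients of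
  p from those of q by plain multiplication.\<close>

lemma Schur_step_fps:
  assumes "p holomorphic_on \<bbbD>" "\<And>z. z \<in> \<bbbD> \<Longrightarrow> norm (p z) \<le> 1" "norm (p 0) < 1"
  obtains q where "q holomorphic_on \<bbbD>" "\<And>z. z \<in> \<bbbD> \<Longrightarrow> norm (q z) \<le> 1"
    "fps_expansion p 0 * (1 + fps_const (cnj (p 0)) * (fps_X * fps_expansion q 0))
       = fps_const (p 0) + fps_X * fps_expansion q 0"
proof -
  obtain q where q: "q holomorphic_on \<bbbD>" "\<And>z. z \<in> \<bbbD> \<Longrightarrow> norm (q z) \<le> 1"
    and eq: "\<And>z. z \<in> \<bbbD> \<Longrightarrow> p z * (1 + cnj (p 0) * (z * q z)) = p 0 + z * q z"
    using Schur_step[OF assms] by metis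
  have [fps_expansion_intros]: "p has_fps_expansion fps_expansion p 0"
       "q has_fps_expansion fps_expansion q 0"
    using assms(1) q(1) by (auto intro!: has_fps_expansion_fps_expansion[of \<bbbD>])
  have "eventually (\<lambda>z. z \<in> \<bbbD>) (nhds 0)"
    by (intro eventually_nhds_in_open) auto
  then have ev: "eventually (\<lambda>z. p z * (1 + cnj (p 0) * (z * q z)) = p 0 + z * q z) (nhds 0)"
    by eventually_elim (rule eq)
  have "(\<lambda>z. p z * (1 + cnj (p 0) * (z * q z))) has_fps_expansion
      fps_expansion p 0 * (1 + fps_const (cnj (p 0)) * (fps_X * fps_expansion q 0))"
    by (intro fps_expansion_intros)
  moreover have "(\<lambda>z. p 0 + z * q z) has_fps_expansion
      fps_const (p 0) + fps_X * fps_expansion q 0"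
    by (intro fps_expansion_intros)
  ultimately show ?thesis
    using has_fps_expansion_cong[OF ev refl] fps_expansion_unique_complex q
    by (intro that[of q]) blast+
qed

lemma fps_expansion_nth_0 [simp]: "fps_nth (fps_expansion f 0) 0 = f 0"
  by (simp add: fps_expansion_def)

lemma fps_expansion_const_on_disc:
  fixes f :: "complex \<Rightarrow> complex"
  assumes "\<And>z. z \<in> \<bbbD> \<Longrightarrow> f z = c"
  shows "fps_expansion f 0 = fps_const c"
proof -
  have "eventually (\<lambda>z. z \<in> \<bbbD>) (nhds 0)"
    by (intro eventually_nhds_in_open) auto
  then have "eventually (\<lambda>z. f z = c) (nhds 0)"
    by eventually_elim (rule assms)
  then show ?thesis
    using has_fps_expansion_cong[of f "\<lambda>_. c"] by (intro fps_expansion_eqI) auto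
qed

lemma bounded_by_1_constant:
  assumes hol: "p holomorphic_on \<bbbD>" and le: "\<And>z. z \<in> \<bbbD> \<Longrightarrow> norm (p z) \<le> 1"
    and 1: "norm (p 0) = 1" and z: "z \<in> \<bbbD>"
  shows "p z = p 0"
proof -
  have "p constant_on \<bbbD>"
    by (rule maximum_modulus_principle[OF hol, where U = \<bbbD> and \<xi> = 0]) (use le 1 in auto)
  then show ?thesis
    using z unfolding constant_on_def by (metis centre_in_ball zero_less_one)
qed

text \<open>With a = p(0), the coefficient of z in the Schur identity reads c1 + |a|^2 q(0) = q(0),
  so c1 = (1 - |a|^2) q(0) with |q(0)| \<le> 1.\<close>

lemma Schur_coeff_1:
  assumes "p holomorphic_on \<bbbD>" "\<And>z. z \<in> \<bbbD> \<Longrightarrow> norm (p z) \<le> 1"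
  shows "norm (fps_nth (fps_expansion p 0) 1) \<le> 1 - (norm (p 0))\<^sup>2"
proof (cases "norm (p 0) = 1")
  case True
  then have "fps_expansion p 0 = fps_const (p 0)"
    using bounded_by_1_constant assms by (intro fps_expansion_const_on_disc) blast
  then have "fps_nth (fps_expansion p 0) 1 = 0" by simp
  then show ?thesis using True by simp
next
  case False
  then have lt: "norm (p 0) < 1"
    using assms(2)[of 0] by simp
  obtain q where q: "\<And>z. z \<in> \<bbbD> \<Longrightarrow> norm (q z) \<le> 1"
    and eq: "fps_expansion p 0 * (1 + fps_const (cnj (p 0)) * (fps_X * fps_expansion q 0))
       = fps_const (p 0) + fps_X * fps_expansion q 0"
    using Schur_step_fps[OF assms lt] by metis
  have "fps_nth (fps_expansion p 0) 1 + p 0 * cnj (p 0) * q 0 = q 0"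
    using arg_cong[OF eq, of "\<lambda>F. fps_nth F 1"]
    by (simp add: fps_mult_nth ac_simps)
  then have "fps_nth (fps_expansion p 0) 1 = of_real (1 - (norm (p 0))\<^sup>2) * q 0"
    by (simp add: complex_norm_square[symmetric] algebra_simps del: of_real_power)
  then have "norm (fps_nth (fps_expansion p 0) 1) = (1 - (norm (p 0))\<^sup>2) * norm (q 0)"
    using lt by (simp add: norm_mult power_le_one del: of_real_diff)
  also have "\<dots> \<le> 1 - (norm (p 0))\<^sup>2"
    using lt q[of 0] by (intro mult_left_le) (auto simp: power_le_one)
  finally show ?thesis .
qed

text \<open>The parameters are x = q(0) and y = the first coefficient of q, where q is the next
  function of the Schur algorithm. The bound on y is therefore \<open>Schur_coeff_1\<close> applied
  to q.\<close>

lemma Schur_coeffs: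
  assumes "p holomorphic_on \<bbbD>" "\<And>z. z \<in> \<bbbD> \<Longrightarrow> norm (p z) \<le> 1"
  defines "a \<equiv> p 0"
  obtains x y where "norm x \<le> 1" "norm y \<le> 1 - (norm x)\<^sup>2"
    "fps_nth (fps_expansion p 0) 1 = of_real (1 - (norm a)\<^sup>2) * x"
    "fps_nth (fps_expansion p 0) 2 = of_real (1 - (norm a)\<^sup>2) * (y - cnj a * x\<^sup>2)"
proof (cases "norm a = 1")
  case True
  then have "fps_expansion p 0 = fps_const (p 0)"
    using bounded_by_1_constant assms by (intro fps_expansion_const_on_disc) blast
  \<comment> \<open>Both coefficients and the factor 1 - |a|^2 vanish, so any admissible pair
    serves.\<close>
  then show ?thesis using True by (intro that[of 0 0]) auto
next
  case False
  then have lt: "norm (p 0) < 1"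
    using assms(2)[of 0] by (simp add: a_def)
  obtain q where q: "q holomorphic_on \<bbbD>" "\<And>z. z \<in> \<bbbD> \<Longrightarrow> norm (q z) \<le> 1"
    and eq: "fps_expansion p 0 * (1 + fps_const (cnj a) * (fps_X * fps_expansion q 0))
       = fps_const a + fps_X * fps_expansion q 0"
    using Schur_step_fps[OF assms(1,2) lt] unfolding a_def by metis
  define y where "y = fps_nth (fps_expansion q 0) 1"
  have k: "of_real (1 - (norm a)\<^sup>2) = 1 - a * cnj a"
    by (simp add: complex_norm_square[symmetric] del: of_real_power)
  have 1: "fps_nth (fps_expansion p 0) 1 = of_real (1 - (norm a)\<^sup>2) * q 0"
    using arg_cong[OF eq, of "\<lambda>F. fps_nth F 1"] unfolding k
    by (simp add: fps_mult_nth algebra_simps a_def)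
  have "fps_nth (fps_expansion p 0) 2 + fps_nth (fps_expansion p 0) 1 * cnj a * q 0 + a * cnj a * y = y"
    using arg_cong[OF eq, of "\<lambda>F. fps_nth F 2"]
    by (simp add: fps_mult_nth numeral_2_eq_2 algebra_simps a_def y_def)
  then have 2: "fps_nth (fps_expansion p 0) 2 = of_real (1 - (norm a)\<^sup>2) * (y - cnj a * (q 0)\<^sup>2)"
    unfolding 1 k by (simp add: algebra_simps power2_eq_square add_eq_0_iff)
  show ?thesis
    using Schur_coeff_1[OF q] q(2)[of 0] 1 2 by (intro that[of "q 0" y]) (auto simp: y_def)
qed

section \<open>The logarithmic inverse coefficients\<close>

text \<open>\<open>inv_into\<close> picks some preimage in the whole disc. Since \<open>|f z| \<ge> |z| exp (-B)\<close>, a small value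
  is attained only near \<open>0\<close>, where \<open>f\<close> is injective, so univalence on the disc is not needed.\<close>

lemma log_inverse_eventually:
  assumes h: "h holomorphic_on \<bbbD>" "h 0 = 0" and B: "\<And>z. z \<in> \<bbbD> \<Longrightarrow> norm (h z) \<le> B"
    and Bpi: "B < pi"
    and f: "\<And>z. z \<in> \<bbbD> \<Longrightarrow> f z = z * exp (h z)"
  obtains g where "g analytic_on {0}" "g 0 = 0" "eventually (\<lambda>w. g w = w * exp (- h (g w))) (nhds 0)"
    "eventually (\<lambda>w. log_inverse f w = - h (g w)) (nhds 0)"
proof -
  have holf: "f holomorphic_on \<bbbD>"
    using f by (subst holomorphic_cong[OF refl f]) (auto intro!: holomorphic_intros h)
  have f0: "f 0 = 0" using f[of 0] by simp
  have "((\<lambda>z. z * exp (h z)) has_field_derivative 1) (at 0)"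
  proof -
    have "(h has_field_derivative deriv h 0) (at 0)"
      using h by (intro holomorphic_derivI[of _ \<bbbD>]) auto
    then show ?thesis by (auto intro!: derivative_eq_intros simp: h(2))
  qed
  then have "(f has_field_derivative 1) (at 0)"
    by (rule has_field_derivative_transform_within_open[where S = \<bbbD>]) (use f in auto)
  then have d: "deriv f 0 \<noteq> 0" by (simp add: DERIV_imp_deriv)
  obtain r where r: "r > 0" "ball 0 r \<subseteq> \<bbbD>" and inj: "inj_on f (ball 0 r)"
    by (rule has_complex_derivative_locally_injective[OF holf _ _ d]) auto
  have holr: "f holomorphic_on ball 0 r"
    using holf r holomorphic_on_subset by blast
  obtain g where g: "g holomorphic_on f ` ball 0 r" "\<And>z. z \<in> ball 0 r \<Longrightarrow> g (f z) = z"
    using holomorphic_has_inverse[OF holr open_ball inj] by metis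
  have op: "open (f ` ball 0 r)"
    using open_mapping_thm3[OF holr _ inj] by simp
  have mem: "0 \<in> f ` ball 0 r"
    using f0 r(1) by (metis centre_in_ball imageI)
  have g0: "g 0 = 0" using g(2)[of 0] f0 r(1) by simp
  define \<delta> where "\<delta> = r * exp (- B)"
  have small: "z \<in> ball 0 r" if "z \<in> \<bbbD>" "norm (f z) < \<delta>" for z
  proof -
    have "- B \<le> Re (h z)"
      using B[OF that(1)] abs_Re_le_cmod[of "h z"] by linarith
    then have "norm z * exp (- B) \<le> norm (f z)"
      using f[OF that(1)] by (auto simp: norm_mult intro!: mult_left_mono)
    also have "\<dots> < r * exp (- B)"
      using that(2) by (simp add: \<delta>_def)
    finally have "norm z * exp (- B) < r * exp (- B)" .
    then show ?thesis by simp
  qed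
  have ev: "eventually (\<lambda>w. w \<in> f ` ball 0 r \<inter> ball 0 \<delta>) (nhds 0)"
    using op mem r(1) by (intro eventually_nhds_in_open) (auto simp: \<delta>_def)
  have eq: "g w = w * exp (- h (g w)) \<and> log_inverse f w = - h (g w)"
    if w: "w \<in> f ` ball 0 r \<inter> ball 0 \<delta>" for w
  proof -
    obtain z where z: "z \<in> ball 0 r" "w = f z" using w by auto
    then have zD: "z \<in> \<bbbD>" using r by auto
    have gw: "g w = z" using z g by simp
    have weq: "w = z * exp (h z)" using f[OF zD] z by simp
    have geq: "g w = w * exp (- h (g w))"
      unfolding gw by (simp add: weq exp_minus)
    have "w \<in> f ` \<bbbD>" using z zD by blast
    then have "inv_into \<bbbD> f w \<in> \<bbbD>" and fi: "f (inv_into \<bbbD> f w) = w"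
      by (rule inv_into_into, rule f_inv_into_f)
    then have "inv_into \<bbbD> f w \<in> ball 0 r"
      using w by (intro small) auto
    then have inv: "inv_into \<bbbD> f w = z"
      using inj z fi by (auto dest: inj_onD)
    have "log_inverse f w = - h z"
    proof (cases "w = 0")
      case True
      then have "z = 0" using weq by simp
      then show ?thesis using True h by (simp add: log_inverse_def)
    next
      case False
      then have "inv_into \<bbbD> f w / w = exp (- h z)"
        unfolding inv using weq by (simp add: exp_minus field_simps)
      \<comment> \<open>Here \<open>B < pi\<close> enters: -h(z) lies in the strip where the
        principal logarithm inverts \<open>exp\<close>, so no multiple of 2 pi i appears.\<close>
      moreover have "\<bar>Im (h z)\<bar> < pi"
        using B[OF zD] Bpi abs_Im_le_cmod[of "h z"] by linarith
      ultimately show ?thesis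
        using False by (simp add: log_inverse_def)
    qed
    then show ?thesis using geq gw by simp
  qed
  show ?thesis
  proof (rule that[of g])
    show "g analytic_on {0}"
      using g(1) op mem by (auto simp: analytic_at)
  qed (use g0 eventually_mono[OF ev] eq in auto)
qed

text \<open>With G the series of the inverse, L = -H(G) and G = X exp(L). The factor X makes this
  system triangular: L up to order n needs G only up to order n, hence L only up to order n - 1, so
  the coefficients follow one after another.\<close>

lemma log_inv_coeffs:
  assumes "h holomorphic_on \<bbbD>" "h 0 = 0" "\<And>z. z \<in> \<bbbD> \<Longrightarrow> norm (h z) \<le> B" "B < pi"
    and "\<And>z. z \<in> \<bbbD> \<Longrightarrow> f z = z * exp (h z)"
  defines "H \<equiv> fps_expansion h 0"
  shows "log_inv_coeff f 1 = - (fps_nth H 1 / 2)"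
    and "log_inv_coeff f 2 = ((fps_nth H 1)\<^sup>2 - fps_nth H 2) / 2"
    and "log_inv_coeff f 3 =
      (3 * fps_nth H 1 * fps_nth H 2 - 3 / 2 * fps_nth H 1 ^ 3 - fps_nth H 3) / 2"
proof -
  obtain g where g: "g analytic_on {0}" "g 0 = 0"
    and geq: "eventually (\<lambda>w. g w = w * exp (- h (g w))) (nhds 0)"
    and leq: "eventually (\<lambda>w. log_inverse f w = - h (g w)) (nhds 0)"
    using log_inverse_eventually[OF assms(1-5)] by metis
  define G where "G = fps_expansion g 0"
  define L where "L = - (H oo G)"
  have G: "g has_fps_expansion G" and G0: "fps_nth G 0 = 0"
    using g by (auto simp: G_def intro: analytic_at_imp_has_fps_expansion_0)
  have H: "h has_fps_expansion H"
    unfolding H_def using assms(1) by (intro has_fps_expansion_fps_expansion[of \<bbbD>]) auto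
  have L: "(\<lambda>w. - h (g w)) has_fps_expansion L"
    using has_fps_expansion_minus[OF has_fps_expansion_compose[OF H G G0]]
    by (simp add: L_def o_def)
  then have "fps_expansion (log_inverse f) 0 = L"
    using has_fps_expansion_cong[OF leq refl] by (intro fps_expansion_eqI) auto
  then have coeff: "log_inv_coeff f n = fps_nth L n / 2" for n
    by (simp add: log_inv_coeff_def)
  have H0: "fps_nth H 0 = 0" using assms(2) by (simp add: H_def)
  then have L0: "fps_nth L 0 = 0" by (simp add: L_def)
  define E where "E = fps_exp 1 oo L"
  have "(\<lambda>w. w * exp (- h (g w))) has_fps_expansion fps_X * E"
    using has_fps_expansion_compose[OF has_fps_expansion_exp1 L L0]
    by (intro fps_expansion_intros) (simp add: E_def o_def)
  then have GE: "G = fps_X * E"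
    using has_fps_expansion_cong[OF geq refl] G fps_expansion_unique_complex by blast
  note expand = fps_compose_nth fps_mult_nth numeral_2_eq_2 numeral_3_eq_3
  have E0: "fps_nth E 0 = 1" by (simp add: E_def)
  have E1: "fps_nth E 1 = fps_nth L 1"
    by (simp add: E_def expand L0)
  have E2: "fps_nth E 2 = fps_nth L 2 + (fps_nth L 1)\<^sup>2 / 2"
    by (simp add: E_def expand L0 power2_eq_square)
  have G1: "fps_nth G 1 = 1" using E0 by (simp add: GE)
  have G2: "fps_nth G 2 = fps_nth L 1" using E1 by (simp add: GE numeral_2_eq_2)
  have G3: "fps_nth G 3 = fps_nth L 2 + (fps_nth L 1)\<^sup>2 / 2" 
    using E2 by (simp add: GE numeral_3_eq_3 numeral_2_eq_2)
  have L1: "fps_nth L 1 = - fps_nth H 1"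
    using G1 by (simp add: L_def expand G0)
  have L2: "fps_nth L 2 = - (fps_nth H 1 * fps_nth G 2 + fps_nth H 2)"
    using G1 by (simp add: L_def expand G0 H0)
  have L3: "fps_nth L 3 = - (fps_nth H 1 * fps_nth G 3 + 2 * fps_nth H 2 * fps_nth G 2 + fps_nth H 3)"
    using G1 by (simp add: L_def expand G0 H0 algebra_simps)
  show "log_inv_coeff f 1 = - (fps_nth H 1 / 2)"
    by (simp add: coeff L1 del: One_nat_def)
  show "log_inv_coeff f 2 = ((fps_nth H 1)\<^sup>2 - fps_nth H 2) / 2"
    by (simp del: One_nat_def add: coeff L2 G2 L1 power2_eq_square)
  show "log_inv_coeff f 3 =
      (3 * fps_nth H 1 * fps_nth H 2 - 3 / 2 * fps_nth H 1 ^ 3 - fps_nth H 3) / 2"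
    by (simp del: One_nat_def add: coeff L3 G3 L2 G2 L1 power2_eq_square power3_eq_cube field_simps)
qed

section \<open>The cardioid class\<close>

text \<open>Writing the Schwarz function as z p(z) turns the subordination into z f'/f = 1 + z h'
  with h' = 4/3 p + 2/3 z p^2. Thus h' is the logarithmic derivative of f(z)/z, and h is its
  primitive vanishing at 0.\<close>

lemma S_car_exp_representation:
  assumes f: "f \<in> S_car"
  obtains p h where "p holomorphic_on \<bbbD>" "\<And>z. z \<in> \<bbbD> \<Longrightarrow> norm (p z) \<le> 1" "h 0 = 0"
    "\<And>z. z \<in> \<bbbD> \<Longrightarrow> (h has_field_derivative 4 / 3 * p z + 2 / 3 * z * (p z)\<^sup>2) (at z)"
    "\<And>z. z \<in> \<bbbD> \<Longrightarrow> f z = z * exp (h z)"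
proof -
  have holf: "f holomorphic_on \<bbbD>" and f0: "f 0 = 0" and df0: "deriv f 0 = 1"
    and nz: "\<And>z. z \<in> \<bbbD> \<Longrightarrow> z \<noteq> 0 \<Longrightarrow> f z \<noteq> 0"
    using f by (auto simp: S_car_def class_A_def)
  obtain w where w: "w holomorphic_on \<bbbD>" "w 0 = 0" "\<And>z. z \<in> \<bbbD> \<Longrightarrow> norm (w z) \<le> norm z"
    and quot: "\<And>z. z \<in> \<bbbD> \<Longrightarrow> starlike_quotient f z = 1 + 4 / 3 * w z + 2 / 3 * (w z)\<^sup>2"
    using f by (auto simp: S_car_def subordinate_def)
  have "norm (w z) \<le> 1" if "z \<in> \<bbbD>" for z
    using w(3)[OF that] that by simp
  then obtain p where p: "p holomorphic_on \<bbbD>" "\<And>z. z \<in> \<bbbD> \<Longrightarrow> w z = z * p z"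
    "\<And>z. z \<in> \<bbbD> \<Longrightarrow> norm (p z) \<le> 1"
    using Schwarz_factor[OF w(1,2)] by metis
  define d where "d z = 4 / 3 * p z + 2 / 3 * z * (p z)\<^sup>2" for z
  have "d holomorphic_on \<bbbD>"
    unfolding d_def by (intro holomorphic_intros p)
  then obtain h0 where h0: "\<And>z. z \<in> \<bbbD> \<Longrightarrow> (h0 has_field_derivative d z) (at z within \<bbbD>)"
    using holomorphic_convex_primitive'[of \<bbbD> d] by auto
  define h where "h z = h0 z - h0 0" for z
  have h: "(h has_field_derivative d z) (at z)" if "z \<in> \<bbbD>" for z
    using h0[OF that] that unfolding h_def
    by (auto intro!: derivative_eq_intros simp: at_within_open[OF that])
  have h00: "h 0 = 0" by (simp add: h_def)
  \<comment> \<open>Showing that u(z)/z is constant on the punctured disc avoids choosing a branch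
    of log (f(z)/z).\<close>
  define u where "u z = f z * exp (- h z)" for z
  have df: "(f has_field_derivative deriv f z) (at z)" if "z \<in> \<bbbD>" for z
    using that holf by (intro holomorphic_derivI[of _ \<bbbD>]) auto
  have du: "(u has_field_derivative (deriv f z - f z * d z) * exp (- h z)) (at z)" if "z \<in> \<bbbD>" for z
    unfolding u_def
    by (rule derivative_eq_intros df h that refl | simp add: algebra_simps)+
  have ode: "z * (deriv f z - f z * d z) = f z" if "z \<in> \<bbbD>" "z \<noteq> 0" for z
  proof -
    have "z * deriv f z / f z = 1 + z * d z"
      using quot[OF that(1)] that p(2)[OF that(1)]
      by (simp add: starlike_quotient_def d_def algebra_simps power2_eq_square)
    then show ?thesis
      using nz[OF that] by (simp add: field_simps)
  qed
  have dv: "((\<lambda>z. u z / z) has_field_derivative 0) (at z)" if z: "z \<in> \<bbbD> - {0}" for z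
  proof -
    have "((\<lambda>z. u z / z) has_field_derivative
        ((deriv f z - f z * d z) * exp (- h z) * z - u z * 1) / (z * z)) (at z)"
      using z by (intro DERIV_divide du DERIV_ident) auto
    moreover have "(deriv f z - f z * d z) * exp (- h z) * z = u z"
      using ode[of z] z by (simp add: u_def mult_ac)
    ultimately show ?thesis by simp
  qed
  have "connected (\<bbbD> - {0})"
    by (intro connected_punctured_ball) simp
  moreover have "continuous_on (\<bbbD> - {0}) (\<lambda>z. u z / z)"
    using dv by (meson DERIV_isCont continuous_at_imp_continuous_on)
  ultimately obtain c where c: "\<And>z. z \<in> \<bbbD> - {0} \<Longrightarrow> u z / z = c"
    using DERIV_zero_connected_constant[of "\<bbbD> - {0}" "{}" "\<lambda>z. u z / z"] dv by auto
  have uc: "u z = c * z" if "z \<in> \<bbbD>" for z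
    using c[of z] that by (cases "z = 0") (auto simp: u_def f0 field_simps)
  \<comment> \<open>The constant is found by computing u'(0) twice: once from u(z) = c z, once from
    f'(0) = 1 and h(0) = 0.\<close>
  have "(u has_field_derivative c) (at 0)"
    by (rule has_field_derivative_transform_within_open[where f = "\<lambda>z. c * z" and S = \<bbbD>])
       (auto intro!: derivative_eq_intros simp: uc)
  moreover have "(u has_field_derivative 1) (at 0)"
    using du[of 0] by (simp add: f0 df0 h00)
  ultimately have "c = 1" using DERIV_unique by blast
  then have "f z = z * exp (h z)" if "z \<in> \<bbbD>" for z
    using uc[OF that] by (simp add: u_def exp_minus field_simps)
  then show ?thesis
    using p h h00 by (intro that[of p h]) (auto simp: d_def)
qed

text \<open>Converse of the exponential representation, with z p(z) as the Schwarz function; it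
  supplies the membership of the extremal function.\<close>

lemma S_carI:
  assumes p: "p holomorphic_on \<bbbD>" "\<And>z. z \<in> \<bbbD> \<Longrightarrow> norm (p z) \<le> 1"
    and h0: "h 0 = 0"
    and h: "\<And>z. z \<in> \<bbbD> \<Longrightarrow> (h has_field_derivative 4 / 3 * p z + 2 / 3 * z * (p z)\<^sup>2) (at z)"
  shows "(\<lambda>z. z * exp (h z)) \<in> S_car"
proof -
  let ?f = "\<lambda>z. z * exp (h z)" and ?g = "\<lambda>z. 1 + 4 / 3 * z + 2 / 3 * z\<^sup>2 :: complex"
  have df: "(?f has_field_derivative
      exp (h z) * (1 + z * (4 / 3 * p z + 2 / 3 * z * (p z)\<^sup>2))) (at z)" if "z \<in> \<bbbD>" for z
    by (rule derivative_eq_intros h that refl | simp add: algebra_simps)+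
  have holf: "?f holomorphic_on \<bbbD>"
    unfolding holomorphic_on_open[OF open_ball] using df by blast
  have quot: "starlike_quotient ?f z = ?g (z * p z)" if "z \<in> \<bbbD>" for z
    by (simp add: starlike_quotient_def DERIV_imp_deriv[OF df[OF that]] field_simps power2_eq_square)
  have "starlike_quotient ?f holomorphic_on \<bbbD>"
    by (subst holomorphic_cong[OF refl quot]) (auto intro!: holomorphic_intros p)
  moreover have "?g holomorphic_on \<bbbD>"
    by (intro holomorphic_intros)
  moreover have "(\<lambda>z. z * p z) holomorphic_on \<bbbD>"
    by (intro holomorphic_intros p)
  moreover have "norm (z * p z) \<le> norm z" if "z \<in> \<bbbD>" for z
    using p(2)[OF that] by (simp add: norm_mult mult_left_le)
  ultimately have "starlike_quotient ?f \<prec>\<^sub>s ?g"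
    unfolding subordinate_def using quot by (intro conjI exI[of _ "\<lambda>z. z * p z"]) auto
  moreover have "deriv ?f 0 = 1"
    using DERIV_imp_deriv[OF df[of 0]] h0 by simp
  ultimately show ?thesis
    using holf by (simp add: S_car_def class_A_def)
qed

lemma S_car_log_inv_hankel:
  assumes p: "p holomorphic_on \<bbbD>" "\<And>z. z \<in> \<bbbD> \<Longrightarrow> norm (p z) \<le> 1"
    and h0: "h 0 = 0"
    and h: "\<And>z. z \<in> \<bbbD> \<Longrightarrow> (h has_field_derivative 4 / 3 * p z + 2 / 3 * z * (p z)\<^sup>2) (at z)"
    and f: "\<And>z. z \<in> \<bbbD> \<Longrightarrow> f z = z * exp (h z)"
  defines "c \<equiv> fps_nth (fps_expansion p 0)"
  shows "log_inv_coeff f 1 * log_inv_coeff f 3 - (log_inv_coeff f 2)\<^sup>2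
    = (71 * c 0 ^ 4 - 84 * (c 0)\<^sup>2 * c 1 + 48 * c 0 * c 2 - 36 * (c 1)\<^sup>2) / 324"
proof -
  define P H where "P = fps_expansion p 0" and "H = fps_expansion h 0"
  have holh: "h holomorphic_on \<bbbD>"
    unfolding holomorphic_on_open[OF open_ball] using h by blast
  have [fps_expansion_intros]: "p has_fps_expansion P" "h has_fps_expansion H"
    unfolding P_def H_def using p(1) holh
    by (auto intro!: has_fps_expansion_fps_expansion[of \<bbbD>])
  have "eventually (\<lambda>z. z \<in> \<bbbD>) (nhds 0)"
    by (intro eventually_nhds_in_open) auto
  then have ev: "eventually (\<lambda>z. deriv h z = 4 / 3 * p z + 2 / 3 * z * (p z)\<^sup>2) (nhds 0)"
    by eventually_elim (use h DERIV_imp_deriv in blast)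
  have "(\<lambda>z. 4 / 3 * p z + 2 / 3 * z * (p z)\<^sup>2) has_fps_expansion
      fps_const (4 / 3) * P + fps_const (2 / 3) * fps_X * P\<^sup>2"
    by (intro fps_expansion_intros)
  moreover have "deriv h has_fps_expansion fps_deriv H"
    by (intro fps_expansion_intros)
  ultimately have eq: "fps_deriv H = fps_const (4 / 3) * P + fps_const (2 / 3) * fps_X * P\<^sup>2"
    using has_fps_expansion_cong[OF ev refl] fps_expansion_unique_complex by blast
  have P: "fps_nth P = c" by (simp add: P_def c_def)
  \<comment> \<open>Coefficient n - 1 of h' gives n times coefficient n of h.\<close>
  have H1: "fps_nth H 1 = 4 / 3 * c 0"
    using arg_cong[OF eq, of "\<lambda>F. fps_nth F 0"] by (simp add: P)
  have H2: "2 * fps_nth H 2 = 4 / 3 * c 1 + 2 / 3 * (c 0)\<^sup>2"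
    using arg_cong[OF eq, of "\<lambda>F. fps_nth F 1"]
    by (simp add: P mult.assoc power2_eq_square numeral_2_eq_2 fps_mult_nth)
  have H3: "3 * fps_nth H 3 = 4 / 3 * c 2 + 4 / 3 * c 0 * c 1"
    using arg_cong[OF eq, of "\<lambda>F. fps_nth F 2"]
    by (simp add: P mult.assoc power2_eq_square numeral_2_eq_2 numeral_3_eq_3 fps_mult_nth)
  \<comment> \<open>Since |h'| \<le> 4/3 + 2/3 = 2 on the unit disc and h(0) = 0, |h| stays at most
    2 < pi, as \<open>log_inv_coeffs\<close> requires.\<close>
  have bound: "norm (h z) \<le> 2" if z: "z \<in> \<bbbD>" for z
  proof -
    have "norm (h z - h 0) \<le> 2 * norm (z - 0)"
    proof (rule field_differentiable_bound[of \<bbbD>])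
      fix z :: complex assume z: "z \<in> \<bbbD>"
      show "(h has_field_derivative 4 / 3 * p z + 2 / 3 * z * (p z)\<^sup>2) (at z within \<bbbD>)"
        using h[OF z] has_field_derivative_at_within by blast
      have "norm z * (norm (p z))\<^sup>2 \<le> 1 * 1\<^sup>2"
        using z p(2)[OF z] by (intro mult_mono power_mono) auto
      then have "norm (4 / 3 * p z) + norm (2 / 3 * z * (p z)\<^sup>2) \<le> 2"
        using p(2)[OF z] by (simp add: norm_mult norm_power)
      then show "norm (4 / 3 * p z + 2 / 3 * z * (p z)\<^sup>2) \<le> 2"
        using norm_triangle_ineq order_trans by blast
    qed (use z in auto)
    then show ?thesis using z h0 by simp
  qed
  have "2 < pi" using pi_gt3 by simp
  then have L: "log_inv_coeff f 1 = - (fps_nth H 1 / 2)"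
    "log_inv_coeff f 2 = ((fps_nth H 1)\<^sup>2 - fps_nth H 2) / 2"
    "log_inv_coeff f 3 = (3 * fps_nth H 1 * fps_nth H 2 - 3 / 2 * fps_nth H 1 ^ 3 - fps_nth H 3) / 2"
    unfolding H_def using log_inv_coeffs[of h 2 f] holh h0 bound f by blast+
  have H2': "fps_nth H 2 = 2 / 3 * c 1 + 1 / 3 * (c 0)\<^sup>2"
    using arg_cong[OF H2, of "\<lambda>x. x / 2"] by (simp add: add_divide_distrib)
  have H3': "fps_nth H 3 = 4 / 9 * c 2 + 4 / 9 * c 0 * c 1"
    using arg_cong[OF H3, of "\<lambda>x. x / 3"] by (simp add: add_divide_distrib)
  show ?thesis
    unfolding L H1 H2' H3' by (simp add: field_simps power2_eq_square power3_eq_cube power4_eq_xxxx)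
qed

section \<open>The sharp bound for the Hankel determinant\<close>

lemma hankel21_log_inv_eq:
  "hankel21_log_inv f = log_inv_coeff f 1 * log_inv_coeff f 3 - (log_inv_coeff f 2)\<^sup>2"
  by (simp add: hankel21_log_inv_def det_2 power2_eq_square)

text \<open>After y is replaced by 1 - t^2, the t^2 coefficient in the bracket is 12 (1 - a)(3 - a)
  \<ge> 0, so the bracket is largest at t = 1, where it equals 36 + 96 a^2. This is at most 71 (1 +
  a^2) because a^2 \<le> 1, and multiplying by 1 - a^2 leaves exactly 71 - 71 a^4.\<close>

lemma hankel_polynomial_bound:
  fixes a t y :: real
  assumes "0 \<le> a" "a \<le> 1" "0 \<le> t" "t \<le> 1" "y \<le> 1 - t\<^sup>2"
  shows "71 * a ^ 4 + (1 - a\<^sup>2) * (84 * a\<^sup>2 * t + 48 * a * y + (36 + 12 * a\<^sup>2) * t\<^sup>2) \<le> 71"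
proof -
  have "0 \<le> (1 - a) * (3 - a)" using assms by simp
  moreover have "t\<^sup>2 \<le> 1" using assms by (simp add: power_le_one)
  ultimately have "(1 - a) * (3 - a) * t\<^sup>2 \<le> (1 - a) * (3 - a)"
    by (rule mult_left_le[rotated])
  moreover have "a * y \<le> a * (1 - t\<^sup>2)" "a\<^sup>2 * t \<le> a\<^sup>2" "a\<^sup>2 \<le> 1"
    using assms by (auto intro: mult_left_mono mult_left_le power_le_one)
  ultimately have "84 * a\<^sup>2 * t + 48 * a * y + (36 + 12 * a\<^sup>2) * t\<^sup>2 \<le> 71 * (1 + a\<^sup>2)"
    by (simp add: algebra_simps power2_eq_square)
  then have "(1 - a\<^sup>2) * (84 * a\<^sup>2 * t + 48 * a * y + (36 + 12 * a\<^sup>2) * t\<^sup>2)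
      \<le> (1 - a\<^sup>2) * (71 * (1 + a\<^sup>2))"
    using \<open>a\<^sup>2 \<le> 1\<close> by (intro mult_left_mono) auto
  also have "\<dots> = 71 - 71 * a ^ 4"
    by (simp add: algebra_simps power2_eq_square power4_eq_xxxx)
  finally show ?thesis by simp
qed

text \<open>In the Schur parameters every term except 71 a^4 carries the factor k = 1 - |a|^2. The
  triangle inequality then reduces the claim to a real inequality in the moduli of a, x and
  y.\<close>

lemma hankel_coeff_bound:
  assumes "p holomorphic_on \<bbbD>" "\<And>z. z \<in> \<bbbD> \<Longrightarrow> norm (p z) \<le> 1"
  defines "c \<equiv> fps_nth (fps_expansion p 0)"
  shows "norm (71 * c 0 ^ 4 - 84 * (c 0)\<^sup>2 * c 1 + 48 * c 0 * c 2 - 36 * (c 1)\<^sup>2) \<le> 71"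
proof -
  define a where "a = c 0"
  have a: "a = p 0" by (simp add: a_def c_def)
  have a1: "norm a \<le> 1" using assms(2)[of 0] a by simp
  define k :: real where "k = 1 - (norm a)\<^sup>2"
  have k0: "k \<ge> 0" using a1 by (simp add: k_def power_le_one)
  obtain x y where x: "norm x \<le> 1" and y: "norm y \<le> 1 - (norm x)\<^sup>2"
    and c1: "c 1 = of_real k * x" and c2: "c 2 = of_real k * (y - cnj a * x\<^sup>2)"
    using Schur_coeffs[OF assms(1,2)] unfolding c_def k_def a by metis
  have k: "of_real k = 1 - a * cnj a"
    by (simp add: k_def complex_norm_square[symmetric] del: of_real_power)
  \<comment> \<open>The x^2 terms of 48 c0 c2 and -36 c1^2 combine, since 48 |a|^2 + 36 (1 - |a|^2)
    = 36 + 12 |a|^2.\<close>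
  have "71 * c 0 ^ 4 - 84 * (c 0)\<^sup>2 * c 1 + 48 * c 0 * c 2 - 36 * (c 1)\<^sup>2
      = 71 * a ^ 4 + of_real k * (48 * a * y - 84 * a\<^sup>2 * x - (36 + 12 * (a * cnj a)) * x\<^sup>2)"
    unfolding c1 c2 a_def[symmetric] k
    by (simp add: algebra_simps power2_eq_square)
  also have "norm \<dots> \<le> 71 * norm a ^ 4
      + k * (84 * (norm a)\<^sup>2 * norm x + 48 * norm a * norm y + (36 + 12 * (norm a)\<^sup>2) * (norm x)\<^sup>2)"
  proof -
    have "36 + 12 * (a * cnj a) = of_real (36 + 12 * (norm a)\<^sup>2)"
      by (simp add: complex_norm_square[symmetric] del: of_real_power)
    then have *: "norm (36 + 12 * (a * cnj a)) = 36 + 12 * (norm a)\<^sup>2"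
      by (simp only: norm_of_real) simp
    have "norm (48 * a * y - 84 * a\<^sup>2 * x - (36 + 12 * (a * cnj a)) * x\<^sup>2)
        \<le> norm (48 * a * y) + norm (84 * a\<^sup>2 * x) + norm ((36 + 12 * (a * cnj a)) * x\<^sup>2)"
      by (meson add_right_mono norm_triangle_ineq4 order_trans)
    also have "\<dots> = 84 * (norm a)\<^sup>2 * norm x + 48 * norm a * norm y + (36 + 12 * (norm a)\<^sup>2) * (norm x)\<^sup>2"
      by (simp only: norm_mult * norm_power norm_numeral)
    finally have "k * norm (48 * a * y - 84 * a\<^sup>2 * x - (36 + 12 * (a * cnj a)) * x\<^sup>2)
        \<le> k * (84 * (norm a)\<^sup>2 * norm x + 48 * norm a * norm y + (36 + 12 * (norm a)\<^sup>2) * (norm x)\<^sup>2)"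
      using k0 by (rule mult_left_mono)
    moreover have "norm (71 * a ^ 4 + of_real k * q) \<le> 71 * norm a ^ 4 + k * norm q" for q
      using norm_triangle_ineq[of "71 * a ^ 4" "of_real k * q"] k0
      by (simp add: norm_mult norm_power)
    ultimately show ?thesis
      by (meson add_left_mono order_trans)
  qed
  also have "\<dots> \<le> 71"
    unfolding k_def using a1 x y by (intro hankel_polynomial_bound) auto
  finally show ?thesis .
qed

theorem theorem3p2:
  shows "(\<forall>f\<in>S_car.
            norm (hankel21_log_inv f)
              = norm (log_inv_coeff f 1 * log_inv_coeff f 3 - (log_inv_coeff f 2)\<^sup>2) \<and>
            norm (log_inv_coeff f 1 * log_inv_coeff f 3 - (log_inv_coeff f 2)\<^sup>2) \<le> 71 / 324) \<and>
         (\<exists>f\<in>S_car. norm (hankel21_log_inv f) = 71 / 324)"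
proof (intro conjI ballI)
  fix f assume "f \<in> S_car"
  then obtain p h where ph: "p holomorphic_on \<bbbD>" "\<And>z. z \<in> \<bbbD> \<Longrightarrow> norm (p z) \<le> 1" "h 0 = 0"
    "\<And>z. z \<in> \<bbbD> \<Longrightarrow> (h has_field_derivative 4 / 3 * p z + 2 / 3 * z * (p z)\<^sup>2) (at z)"
    "\<And>z. z \<in> \<bbbD> \<Longrightarrow> f z = z * exp (h z)"
    by (rule S_car_exp_representation) blast
  show "norm (log_inv_coeff f 1 * log_inv_coeff f 3 - (log_inv_coeff f 2)\<^sup>2) \<le> 71 / 324"
    by (subst S_car_log_inv_hankel[where h = h and p = p])
       (use ph hankel_coeff_bound[OF ph(1,2)] in \<open>auto simp: norm_divide\<close>)
next
  \<comment> \<open>The Schwarz function is z itself, and h integrates 4/3 + 2/3 z. Then c0 = 1 and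
    c1 = c2 = 0, so only the term 71 c0^4 survives.\<close>
  define p h :: "complex \<Rightarrow> complex" where "p z = 1" and "h z = 4 / 3 * z + z\<^sup>2 / 3" for z
  have ph: "p holomorphic_on \<bbbD>" "\<And>z. z \<in> \<bbbD> \<Longrightarrow> norm (p z) \<le> 1" "h 0 = 0"
    "\<And>z. z \<in> \<bbbD> \<Longrightarrow> (h has_field_derivative 4 / 3 * p z + 2 / 3 * z * (p z)\<^sup>2) (at z)"
    unfolding p_def h_def by (auto intro!: derivative_eq_intros holomorphic_intros)
  let ?f = "\<lambda>z. z * exp (h z)"
  have "fps_expansion p 0 = fps_const 1"
    by (rule fps_expansion_const_on_disc) (simp add: p_def)
  then have "hankel21_log_inv ?f = 71 / 324"
    unfolding hankel21_log_inv_eq by (subst S_car_log_inv_hankel[where h = h and p = p]) (use ph in auto)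
  moreover have "?f \<in> S_car" using ph by (rule S_carI)
  ultimately show "\<exists>f\<in>S_car. norm (hankel21_log_inv f) = 71 / 324"
    by (intro bexI[of _ ?f]) (simp_all only: norm_divide norm_numeral)
qed (simp add: hankel21_log_inv_eq)

end
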